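(* Let $\mathcal{C}(O,R)$ and $\mathcal{E}(N,r)$ be the circumcircle (center $O$, radius $R$) and the Euler circle (center $N$, radius $r$) of a triangle $\triangle ABC$ in the Euclidean plane. Then $r=\frac{R}{2}$. Further: (i) if $\triangle ABC$ is acute, then $ON<\frac{R}{2}$; (ii) if $\triangle ABC$ is right-angled, then $ON=\frac{R}{2}$; (iii) if $\triangle ABC$ is obtuse, then $ON>\frac{R}{2}$.
   Context: The Euler circle (nine-point circle) of a triangle is the circle through the midpoints of its three sides. $ON$ denotes the distance between the points $O$ and $N$. *)

theory Defs
  imports "HOL-Analysis.Analysis"
begin

definition is_triangle :: "real^2 \<Rightarrow> real^2 \<Rightarrow> real^2 \<Rightarrow> bool" where
  "is_triangle A B C \<longleftrightarrow> \<not> collinear {A, B, C}"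

text \<open>The unoriented angle at the middle argument, a value in the interval from 0 to pi.
  It is only meaningful if the vertex differs from both other points, which always
  holds in a nondegenerate triangle.\<close>

definition angle_at :: "real^2 \<Rightarrow> real^2 \<Rightarrow> real^2 \<Rightarrow> real" where
  "angle_at A B C = arccos (((A - B) \<bullet> (C - B)) / (norm (A - B) * norm (C - B)))"

definition acute_triangle :: "real^2 \<Rightarrow> real^2 \<Rightarrow> real^2 \<Rightarrow> bool" where
  "acute_triangle A B C \<longleftrightarrow> is_triangle A B C \<and>
     angle_at B A C < pi / 2 \<and> angle_at A B C < pi / 2 \<and> angle_at A C B < pi / 2"

definition right_triangle :: "real^2 \<Rightarrow> real^2 \<Rightarrow> real^2 \<Rightarrow> bool" where
  "right_triangle A B C \<longleftrightarrow> is_triangle A B C \<and>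
     (angle_at B A C = pi / 2 \<or> angle_at A B C = pi / 2 \<or> angle_at A C B = pi / 2)"

definition obtuse_triangle :: "real^2 \<Rightarrow> real^2 \<Rightarrow> real^2 \<Rightarrow> bool" where
  "obtuse_triangle A B C \<longleftrightarrow> is_triangle A B C \<and>
     (angle_at B A C > pi / 2 \<or> angle_at A B C > pi / 2 \<or> angle_at A C B > pi / 2)"

text \<open>A circle is given by its centre and radius. For a nondegenerate triangle, centre and
  radius are uniquely determined by the following predicates; the radius is then
  automatically positive, since the sphere contains distinct points.\<close>

definition is_circumcircle ::
  "real^2 \<Rightarrow> real^2 \<Rightarrow> real^2 \<Rightarrow> real^2 \<Rightarrow> real \<Rightarrow> bool" where
  "is_circumcircle A B C Z R \<longleftrightarrow> {A, B, C} \<subseteq> sphere Z R"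

definition is_euler_circle ::
  "real^2 \<Rightarrow> real^2 \<Rightarrow> real^2 \<Rightarrow> real^2 \<Rightarrow> real \<Rightarrow> bool" where
  "is_euler_circle A B C N r \<longleftrightarrow>
     {midpoint B C, midpoint C A, midpoint A B} \<subseteq> sphere N r"

end

theory Submission
  imports Defs
begin

text \<open>Put the circumcentre at the origin and let \<open>a, b, c\<close> be the vertices, all of norm \<open>R\<close>.
  The point \<open>(a + b + c) / 2\<close> has distance \<open>R / 2\<close> from each midpoint of a side, so it is
  the centre \<open>N\<close>, because only one point is equidistant from three non-collinear points.
  Hence \<open>ON\<^sup>2 - (R / 2)\<^sup>2 = (R\<^sup>2 + a \<bullet> b + b \<bullet> c + c \<bullet> a) / 2\<close>.
  As the Gram determinant of three plane vectors vanishes, this quantity is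
  a negative multiple of the product of the inner products of the sides at the three vertices,
  which is positive, zero or negative according to the type of the triangle
  (at most one of the three factors is not positive).\<close>

text \<open>\<open>arccos\<close> is strictly decreasing on [-1, 1] and takes the value
  \<open>pi / 2\<close> at 0, so only the sign of the inner product matters. Cauchy-Schwarz puts the
  quotient into that interval.\<close>

lemma angle_at_compare_right:
  assumes "A \<noteq> B" "C \<noteq> B"
  shows "angle_at A B C < pi / 2 \<longleftrightarrow> (A - B) \<bullet> (C - B) > 0"
    and "angle_at A B C > pi / 2 \<longleftrightarrow> (A - B) \<bullet> (C - B) < 0"
    and "angle_at A B C = pi / 2 \<longleftrightarrow> (A - B) \<bullet> (C - B) = 0"
proof -
  define m where "m = norm (A - B) * norm (C - B)"
  define q where "q = (A - B) \<bullet> (C - B) / m"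
  have m: "m > 0" using assms by (simp add: m_def)
  have "\<bar>(A - B) \<bullet> (C - B)\<bar> \<le> m"
    unfolding m_def by (rule Cauchy_Schwarz_ineq2)
  then have q: "\<bar>q\<bar> \<le> 1" using m by (simp add: q_def)
  have angle: "angle_at A B C = arccos q" by (simp add: angle_at_def q_def m_def)
  have lt: "angle_at A B C < pi / 2 \<longleftrightarrow> q > 0"
    using arccos_less_mono[of q 0] q angle by simp
  have gt: "angle_at A B C > pi / 2 \<longleftrightarrow> q < 0"
    using arccos_less_mono[of 0 q] q angle by simp
  show "angle_at A B C < pi / 2 \<longleftrightarrow> (A - B) \<bullet> (C - B) > 0"
    using lt m by (simp add: q_def zero_less_divide_iff)
  show "angle_at A B C > pi / 2 \<longleftrightarrow> (A - B) \<bullet> (C - B) < 0"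
    using gt m by (simp add: q_def divide_less_0_iff)
  show "angle_at A B C = pi / 2 \<longleftrightarrow> (A - B) \<bullet> (C - B) = 0"
    using lt gt m by (auto simp: q_def zero_less_divide_iff divide_less_0_iff not_less_iff_gr_or_eq)
qed

text \<open>In the plane the vectors orthogonal to a nonzero \<open>d\<close> form a line. This
  yields the uniqueness of the Euler centre.\<close>

lemma collinear_if_orthogonal:
  fixes A B C d :: "real^2"
  assumes "d \<noteq> 0" "d \<bullet> (A - B) = 0" "d \<bullet> (A - C) = 0"
  shows "collinear {A, B, C}"
proof -
  \<comment> \<open>\<open>e\<close> is \<open>d\<close> turned by a right angle.\<close>
  define e :: "real^2" where "e = vector [- (d $ 2), d $ 1]"
  have dd: "d \<bullet> d \<noteq> 0" using assms(1) by simp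
  have par: "\<exists>k. p = k *\<^sub>R e" if "d \<bullet> p = 0" for p
  proof
    have z: "d $ 1 * p $ 1 + d $ 2 * p $ 2 = 0"
      using that by (simp add: inner_vec_def sum_2)
    \<comment> \<open>As \<open>e\<close> has the same length as \<open>d\<close>, this says that
      \<open>p\<close> equals its projection onto \<open>e\<close>, with the denominator
      cleared.\<close>
    have "(d \<bullet> d) *\<^sub>R p = (p \<bullet> e) *\<^sub>R e"
      unfolding vec_eq_iff forall_2 e_def using z
      by (simp add: inner_vec_def sum_2; algebra)
    then have "(1 / (d \<bullet> d)) *\<^sub>R ((d \<bullet> d) *\<^sub>R p) = (1 / (d \<bullet> d)) *\<^sub>R ((p \<bullet> e) *\<^sub>R e)"
      by simp
    then show "p = (p \<bullet> e / (d \<bullet> d)) *\<^sub>R e" using dd by simp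
  qed
  have "d \<bullet> (x - y) = 0" if "x \<in> {A, B, C}" "y \<in> {A, B, C}" for x y
    using that assms(2,3) by (auto simp: inner_diff_right)
  then show ?thesis unfolding collinear_def using par by blast
qed

text \<open>Three plane vectors are linearly dependent, so their Gram determinant vanishes; here it
  is expanded, with its negative terms moved to the right.\<close>

lemma gram_determinant_eq_0:
  fixes a b c :: "real^2"
  shows "(a \<bullet> a) * (b \<bullet> b) * (c \<bullet> c) + 2 * (b \<bullet> c) * (c \<bullet> a) * (a \<bullet> b)
    = (a \<bullet> a) * (b \<bullet> c)\<^sup>2 + (b \<bullet> b) * (c \<bullet> a)\<^sup>2 + (c \<bullet> c) * (a \<bullet> b)\<^sup>2"
  by (simp add: inner_vec_def sum_2; algebra)

lemma euler_circle_centre_radius: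
  assumes tri: "is_triangle A B C"
    and circ: "is_circumcircle A B C Z R"
    and euler: "is_euler_circle A B C N r"
  shows "N - Z = (1/2) *\<^sub>R ((A - Z) + (B - Z) + (C - Z))" and "r = R / 2"
proof -
  define a b c n where "a = A - Z" and "b = B - Z" and "c = C - Z" and "n = N - Z"
  \<comment> \<open>Relative to \<open>Z\<close>, \<open>a + b + c\<close> is the orthocentre, so
    \<open>h\<close> is the midpoint between circumcentre and orthocentre, the expected position of
    \<open>N\<close>.\<close>
  define h where "h = (1/2) *\<^sub>R (a + b + c)"
  have R: "norm a = R" "norm b = R" "norm c = R"
    using circ by (auto simp: is_circumcircle_def a_def b_def c_def dist_norm norm_minus_commute)
  have vertices: "A = a + Z" "B = b + Z" "C = c + Z" "N = n + Z"
    by (simp_all add: a_def b_def c_def n_def)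
  have mid: "N - midpoint B C = n - h + (1/2) *\<^sub>R a" "N - midpoint C A = n - h + (1/2) *\<^sub>R b"
    "N - midpoint A B = n - h + (1/2) *\<^sub>R c"
    unfolding vertices midpoint_def h_def
    by (simp_all add: vec_eq_iff field_simps)
  have r: "norm (n - h + (1/2) *\<^sub>R a) = r" "norm (n - h + (1/2) *\<^sub>R b) = r"
    "norm (n - h + (1/2) *\<^sub>R c) = r"
    using euler by (simp_all add: is_euler_circle_def dist_norm mid)
  have sq: "(norm (d + (1/2) *\<^sub>R p))\<^sup>2 = d \<bullet> d + d \<bullet> p + (norm p)\<^sup>2 / 4" for d p :: "real^2"
    by (simp add: power2_norm_eq_inner inner_add_left inner_add_right inner_commute)
  \<comment> \<open>By \<open>sq\<close>, each squared distance \<open>r\<^sup>2\<close> is a common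
    term plus the inner product of \<open>n - h\<close> with a vertex vector, since all these
    vectors have norm \<open>R\<close>. Hence the three inner products agree, and
    \<open>n - h\<close> is orthogonal to two sides.\<close>
  have "(n - h) \<bullet> (A - B) = 0" "(n - h) \<bullet> (A - C) = 0"
    using sq[of "n - h" a] sq[of "n - h" b] sq[of "n - h" c] r R
    by (simp_all add: vertices inner_diff_right)
  then have "n - h = 0"
    using collinear_if_orthogonal tri unfolding is_triangle_def by blast
  then show "N - Z = (1/2) *\<^sub>R ((A - Z) + (B - Z) + (C - Z))" "r = R / 2"
    using r(1) R(1) by (simp_all add: n_def h_def a_def b_def c_def)
qed

lemma product_of_vertex_inner_products:
  fixes a b c :: "real^2"
  assumes R: "norm a = R" "norm b = R" "norm c = R"
  shows "4 * R\<^sup>2 * (((b - a) \<bullet> (c - a)) * ((a - b) \<bullet> (c - b)) * ((a - c) \<bullet> (b - c)))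
    = - (R\<^sup>2 + a \<bullet> b + b \<bullet> c + c \<bullet> a) * ((norm (a - b))\<^sup>2 * (norm (b - c))\<^sup>2 * (norm (c - a))\<^sup>2)"
proof -
  define s x y z where "s = R\<^sup>2" and "x = b \<bullet> c" and "y = c \<bullet> a" and "z = a \<bullet> b"
  have inner: "a \<bullet> a = s" "b \<bullet> b = s" "c \<bullet> c = s" "b \<bullet> c = x" "c \<bullet> b = x" "c \<bullet> a = y"
    "a \<bullet> c = y" "a \<bullet> b = z" "b \<bullet> a = z"
    using R by (simp_all add: s_def x_def y_def z_def inner_commute flip: power2_norm_eq_inner)
  have gram: "s * s * s + 2 * x * y * z = s * x\<^sup>2 + s * y\<^sup>2 + s * z\<^sup>2"
    using gram_determinant_eq_0[of a b c] by (simp add: inner)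
  \<comment> \<open>The difference of the two sides of the claim, written in inner products, is a
    multiple of the Gram determinant; the cofactor is
    \<open>4 * (3 * s - x - y - z)\<close>.\<close>
  have "4 * s * ((s + x - y - z) * (s + y - x - z) * (s + z - x - y))
      + (s + z + x + y) * ((2 * s - 2 * z) * (2 * s - 2 * x) * (2 * s - 2 * y))
    = 4 * (3 * s - x - y - z) * (s * s * s + 2 * x * y * z - (s * x\<^sup>2 + s * y\<^sup>2 + s * z\<^sup>2))"
    by algebra
  then have "4 * s * ((s + x - y - z) * (s + y - x - z) * (s + z - x - y))
      = - (s + z + x + y) * ((2 * s - 2 * z) * (2 * s - 2 * x) * (2 * s - 2 * y))"
    using gram by algebra
  moreover have "(b - a) \<bullet> (c - a) = s + x - y - z" "(a - b) \<bullet> (c - b) = s + y - x - z"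
    "(a - c) \<bullet> (b - c) = s + z - x - y" "(norm (a - b))\<^sup>2 = 2 * s - 2 * z"
    "(norm (b - c))\<^sup>2 = 2 * s - 2 * x" "(norm (c - a))\<^sup>2 = 2 * s - 2 * y"
    by (simp_all add: power2_norm_eq_inner inner_diff_left inner_diff_right inner)
  ultimately show ?thesis by (simp add: inner flip: s_def)
qed

theorem theorem2:
  fixes A B C Z N :: "real^2" and R r :: real
  assumes "is_triangle A B C"
    and "is_circumcircle A B C Z R"
    and "is_euler_circle A B C N r"
  shows "r = R / 2 \<and>
    (acute_triangle A B C \<longrightarrow> dist Z N < R / 2) \<and>
    (right_triangle A B C \<longrightarrow> dist Z N = R / 2) \<and>
    (obtuse_triangle A B C \<longrightarrow> dist Z N > R / 2)"
proof -
  define a b c where "a = A - Z" and "b = B - Z" and "c = C - Z"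
  have R: "norm a = R" "norm b = R" "norm c = R"
    using assms(2)
    by (auto simp: is_circumcircle_def a_def b_def c_def dist_norm norm_minus_commute)
  have ne: "A \<noteq> B" "B \<noteq> C" "C \<noteq> A"
    using assms(1) by (auto simp: is_triangle_def insert_commute)
  then have "norm a > 0 \<or> norm b > 0" by (auto simp: a_def b_def)
  then have Rpos: "R > 0" using R by simp
  define Q where "Q = R\<^sup>2 + a \<bullet> b + b \<bullet> c + c \<bullet> a"
  have "(dist Z N)\<^sup>2 = (norm ((1/2) *\<^sub>R (a + b + c)))\<^sup>2"
    using euler_circle_centre_radius(1)[OF assms]
    by (simp add: dist_norm norm_minus_commute a_def b_def c_def)
  also have "\<dots> = (a \<bullet> a + b \<bullet> b + c \<bullet> c + 2 * (a \<bullet> b + b \<bullet> c + c \<bullet> a)) / 4"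
    unfolding power2_norm_eq_inner
    by (simp add: inner_add_left inner_add_right inner_commute field_simps)
  also have "\<dots> = (R / 2)\<^sup>2 + Q / 2"
    using R by (simp add: Q_def power2_eq_square flip: power2_norm_eq_inner)
  finally have dist: "(dist Z N)\<^sup>2 = (R / 2)\<^sup>2 + Q / 2" .
  \<comment> \<open>Both \<open>dist Z N\<close> and \<open>R / 2\<close> are nonnegative, so they
    compare as their squares do.\<close>
  have dist_cmp: "dist Z N < R / 2 \<longleftrightarrow> Q < 0" "dist Z N > R / 2 \<longleftrightarrow> Q > 0"
    "dist Z N = R / 2 \<longleftrightarrow> Q = 0"
    using abs_le_square_iff[of "R / 2" "dist Z N"] abs_le_square_iff[of "dist Z N" "R / 2"]
      dist Rpos by auto
  define u v w where "u = (B - A) \<bullet> (C - A)" and "v = (A - B) \<bullet> (C - B)"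
    and "w = (A - C) \<bullet> (B - C)"
  define P where "P = (norm (A - B))\<^sup>2 * (norm (B - C))\<^sup>2 * (norm (C - A))\<^sup>2"
  have P: "P > 0" using ne by (simp add: P_def)
  have prod: "4 * R\<^sup>2 * (u * v * w) = - Q * P"
    using product_of_vertex_inner_products[OF R]
    by (simp add: u_def v_def w_def Q_def P_def a_def b_def c_def)
  have R4: "4 * R\<^sup>2 > 0" using Rpos by simp
  \<comment> \<open>In \<open>prod\<close> the factors \<open>4 * R\<^sup>2\<close> and
    \<open>P\<close> are positive, so \<open>Q\<close> and \<open>u * v * w\<close> have opposite
    signs.\<close>
  have Q: "Q < 0 \<longleftrightarrow> u * v * w > 0" "Q > 0 \<longleftrightarrow> u * v * w < 0" "Q = 0 \<longleftrightarrow> u * v * w = 0"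
  proof -
    have "Q < 0 \<longleftrightarrow> - Q * P > 0" "Q > 0 \<longleftrightarrow> - Q * P < 0" "Q = 0 \<longleftrightarrow> - Q * P = 0"
      using P by (auto simp: zero_less_mult_iff mult_less_0_iff)
    moreover have "u * v * w > 0 \<longleftrightarrow> 4 * R\<^sup>2 * (u * v * w) > 0"
      "u * v * w < 0 \<longleftrightarrow> 4 * R\<^sup>2 * (u * v * w) < 0"
      "u * v * w = 0 \<longleftrightarrow> 4 * R\<^sup>2 * (u * v * w) = 0"
      using zero_less_mult_iff[of "4 * R\<^sup>2" "u * v * w"] mult_less_0_iff[of "4 * R\<^sup>2" "u * v * w"]
        mult_eq_0_iff[of "4 * R\<^sup>2" "u * v * w"] R4 by auto
    ultimately show "Q < 0 \<longleftrightarrow> u * v * w > 0" "Q > 0 \<longleftrightarrow> u * v * w < 0" "Q = 0 \<longleftrightarrow> u * v * w = 0"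
      unfolding prod by blast+
  qed
  \<comment> \<open>Any two of \<open>u\<close>, \<open>v\<close>, \<open>w\<close> add up to the
    square of a side, hence at most one of them is not positive. In the obtuse case this forces the
    other two factors to be positive.\<close>
  have "u + v = (norm (A - B))\<^sup>2" "v + w = (norm (B - C))\<^sup>2" "w + u = (norm (C - A))\<^sup>2"
    unfolding u_def v_def w_def power2_norm_eq_inner
    by (simp_all add: inner_diff_left inner_diff_right inner_commute)
  then have sums: "u + v > 0" "v + w > 0" "w + u > 0" using ne by simp_all
  note angle_A = angle_at_compare_right[of B A C, folded u_def]
  note angle_B = angle_at_compare_right[of A B C, folded v_def]
  note angle_C = angle_at_compare_right[of A C B, folded w_def]
  have "acute_triangle A B C \<longrightarrow> u * v * w > 0"
    using angle_A angle_B angle_C ne by (auto simp: acute_triangle_def)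
  moreover have "right_triangle A B C \<longrightarrow> u * v * w = 0"
    using angle_A angle_B angle_C ne by (auto simp: right_triangle_def)
  moreover have "obtuse_triangle A B C \<longrightarrow> u * v * w < 0"
  proof
    assume "obtuse_triangle A B C"
    then have "u < 0 \<or> v < 0 \<or> w < 0"
      using angle_A angle_B angle_C ne by (auto simp: obtuse_triangle_def)
    then have "u < 0 \<and> v > 0 \<and> w > 0 \<or> v < 0 \<and> w > 0 \<and> u > 0 \<or> w < 0 \<and> u > 0 \<and> v > 0"
      using sums by linarith
    then show "u * v * w < 0" by (auto simp: mult_less_0_iff zero_less_mult_iff)
  qed
  ultimately show ?thesis
    using euler_circle_centre_radius(2)[OF assms] dist_cmp Q by blast
qed

end
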